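(* Let $F$ be a face in a conformingly marked AMP mesh. The trace triangles induced on $F$ from either side form the same intrinsic binary marked-face refinement tree $\mathbb F(F)$ rooted at $F$ (that is, the tree of triangles and their marks depends only on the marked triangle $(F,\mu_F)$). An ambient tetrahedral bisection of a tetrahedron having a current trace triangle $G$ as a face either leaves $G$ unchanged with the same mark, or splits $G$ at the midpoint of its marked edge. Consequently, every nontrivial trace refinement of $F$ contains $$b_F:=\operatorname{mid}(\mu_F),$$ and $b_F$ is created before every vertex introduced at a proper descendant of the root.
   Context: **Notation.** Tetrahedra are closed and nondegenerate in $\mathbb R^3$; $[v_0,v_1,\dots]$ is the convex hull; $\mathcal V(X),\mathcal E(X),\mathcal F(X)$ are the sets of vertices, edges, triangular faces of a tetrahedron or mesh $X$; $\operatorname{mid}(e)$ is the midpoint of $e$. **Marked tetrahedron.** A tetrahedron $K$ with a refinement edge $e(K)\in\mathcal E(K)$, a marked edge $\mu_F\in\mathcal E(F)$ for every $F\in\mathcal F(K)$, and a Boolean flag, such that the two faces containing $e(K)$ (refinement faces) have mark $e(K)$; the flag may be set only if the four face marks are coplanar. The other two faces are the nonrefinement faces. Types: $P$ if all face marks are coplanar ($P_u$ flag unset, $P_f$ flag set); $A$ if the marks of both nonrefinement faces meet $e(K)$ but the four marks are not coplanar; $O$ if neither of these two marks meets $e(K)$; $M$ if exactly one does. **Bisection.** For $K=[v_0,v_1,v_2,v_3]$ with $e(K)=[v_0,v_1]$ and $m=\operatorname{mid}([v_0,v_1])$, the children are $K_0=[v_0,m,v_2,v_3]$ and $K_1=[m,v_1,v_2,v_3]$,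 marked as follows: (B1) the inherited face of a child (a face of $K$) keeps its mark, and this mark is the refinement edge of the child; (B2) a cut face (a proper subtriangle of a face of $K$) is marked by its edge opposite $m$; (B3) the common new face $[m,v_2,v_3]$ is marked by $[v_2,v_3]$, except if $K$ has type $P_f$, when it is marked by $[m,w]$ with $w\in\{v_2,v_3\}$ the common old endpoint of the two child refinement edges; (B4) the child flags are set iff $K$ has type $P_u$. **Meshes.** A tetrahedral mesh is a finite collection of tetrahedra with pairwise disjoint interiors (triangulating a polyhedral domain). It is conforming if two distinct elements intersect in the empty set, a common vertex, a common edge or a common face. An AMP marked mesh is a mesh of marked tetrahedra; it is conformingly marked if it is conforming and any shared face gets the same mark from both sides. **Trace triangles.** For a face $F$ of the mesh and a tetrahedron incident to $F$ (a side of $F$), the triangular faces $G\subseteq F$ of the tetrahedra produced from it by repeated bisection are the trace triangles of $F$ from that side, each carrying its mark $\mu_G$. At any stage the current trace triangles (those that are faces of unbisected descendants) form the triangulation induced on $F$ from that side; it is a nontrivial trace refinement if it differs from $\{F\}$. The trace triangles are ordered into a tree rooted at $F$ by the splitting of a trace triangle into the smaller ones that replace it. *)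

theory Defs
  imports "HOL-Analysis.Analysis"
begin

type_synonym point = "real^3"

(* A simplex is represented by its vertex set; the closed geometric simplex is the
   convex hull of that set.  So edges and triangular faces are 2- and 3-element
   vertex sets. *)
definition edges :: "point set \<Rightarrow> point set set" where
  "edges X = {e. e \<subseteq> X \<and> card e = 2}"

definition triangles :: "point set \<Rightarrow> point set set" where
  "triangles X = {F. F \<subseteq> X \<and> card F = 3}"

definition mid :: "point set \<Rightarrow> point" where
  "mid e = (\<Sum>v\<in>e. v) /\<^sub>R 2"

lemma mid_pair: "a \<noteq> b \<Longrightarrow> mid {a, b} = midpoint a b"
  by (simp add: mid_def midpoint_def)

(* Only the values of fmark on the faces of the tetrahedron are meaningful. *)
record marked_tet =
  verts :: "point set"
  redge :: "point set"
  fmark :: "point set \<Rightarrow> point set"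
  flag :: bool

definition faces :: "marked_tet \<Rightarrow> point set set" where
  "faces K = triangles (verts K)"

definition type_P :: "marked_tet \<Rightarrow> bool" where
  "type_P K \<longleftrightarrow> coplanar (\<Union>F\<in>faces K. convex hull (fmark K F))"

definition type_Pu :: "marked_tet \<Rightarrow> bool" where
  "type_Pu K \<longleftrightarrow> type_P K \<and> \<not> flag K"

definition type_Pf :: "marked_tet \<Rightarrow> bool" where
  "type_Pf K \<longleftrightarrow> type_P K \<and> flag K"

definition marked_tetrahedron :: "marked_tet \<Rightarrow> bool" where
  "marked_tetrahedron K \<longleftrightarrow>
     card (verts K) = 4 \<and> \<not> affine_dependent (verts K) \<and>
     redge K \<in> edges (verts K) \<and>
     (\<forall>F\<in>faces K. fmark K F \<in> edges F) \<and>
     (\<forall>F\<in>faces K. redge K \<subseteq> F \<longrightarrow> fmark K F = redge K) \<and>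
     (flag K \<longrightarrow> coplanar (\<Union>F\<in>faces K. convex hull (fmark K F)))"

(* For b in redge K, the child that loses b keeps the face of K opposite b (its
   inherited face); the mark of that face is the refinement edge of the child. *)
definition child_redge :: "marked_tet \<Rightarrow> point \<Rightarrow> point set" where
  "child_redge K b = fmark K (verts K - {b})"

definition new_face :: "marked_tet \<Rightarrow> point set" where
  "new_face K = insert (mid (redge K)) (verts K - redge K)"

definition new_face_mark :: "marked_tet \<Rightarrow> point set" where
  "new_face_mark K =
     (if type_Pf K
      then {mid (redge K),
            THE w. w \<in> verts K - redge K \<and> (\<forall>b\<in>redge K. w \<in> child_redge K b)}
      else verts K - redge K)"

(* The three cases are: inherited face, common new face, cut face. *)
definition child_mark :: "marked_tet \<Rightarrow> point set \<Rightarrow> point set" where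
  "child_mark K F =
     (if F \<in> faces K then fmark K F
      else if F = new_face K then new_face_mark K
      else F - {mid (redge K)})"

definition child :: "marked_tet \<Rightarrow> point \<Rightarrow> marked_tet" where
  "child K b =
     \<lparr>verts = insert (mid (redge K)) (verts K - {b}),
      redge = child_redge K b,
      fmark = child_mark K,
      flag = type_Pu K\<rparr>"

definition children :: "marked_tet \<Rightarrow> marked_tet set" where
  "children K = child K ` redge K"

definition descendants :: "marked_tet \<Rightarrow> marked_tet set" where
  "descendants K = {L. (K, L) \<in> {(A, B). B \<in> children A}\<^sup>*}"

(* The triangulated polyhedron is the union of the elements; it needs no separate
   name.  Disjointness of interiors forces distinct elements of T to have distinct
   vertex sets. *)
definition amp_mesh :: "marked_tet set \<Rightarrow> bool" where
  "amp_mesh T \<longleftrightarrow>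
     finite T \<and> (\<forall>K\<in>T. marked_tetrahedron K) \<and>
     (\<forall>K\<in>T. \<forall>L\<in>T. K \<noteq> L \<longrightarrow>
        interior (convex hull (verts K)) \<inter> interior (convex hull (verts L)) = {})"

(* card S = 0, 1, 2, 3: empty set, common vertex, common edge, common face. *)
definition conforming :: "marked_tet set \<Rightarrow> bool" where
  "conforming T \<longleftrightarrow>
     (\<forall>K\<in>T. \<forall>L\<in>T. K \<noteq> L \<longrightarrow>
        (\<exists>S. S \<subseteq> verts K \<and> S \<subseteq> verts L \<and> card S \<le> 3 \<and>
             convex hull (verts K) \<inter> convex hull (verts L) = convex hull S))"

definition conformingly_marked :: "marked_tet set \<Rightarrow> bool" where
  "conformingly_marked T \<longleftrightarrow>
     amp_mesh T \<and> conforming T \<and>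
     (\<forall>K\<in>T. \<forall>L\<in>T. \<forall>F\<in>faces K \<inter> faces L. fmark K F = fmark L F)"

type_synonym marked_triangle = "point set \<times> point set"

definition sides :: "marked_tet set \<Rightarrow> point set \<Rightarrow> marked_tet set" where
  "sides T F = {K\<in>T. F \<in> faces K}"

definition marked_faces :: "marked_tet set \<Rightarrow> marked_triangle set" where
  "marked_faces T = {(F, fmark K F) |K F. K \<in> T \<and> F \<in> faces K}"

(* The marked faces of the tetrahedra in S that lie in the triangle F. *)
definition face_trace :: "point set \<Rightarrow> marked_tet set \<Rightarrow> marked_triangle set" where
  "face_trace F S =
     {(G, fmark L G) |L G. L \<in> S \<and> G \<in> faces L \<and> convex hull G \<subseteq> convex hull F}"

definition trace_vertices :: "point set \<Rightarrow> marked_tet set \<Rightarrow> point set" where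
  "trace_vertices F S = \<Union> (fst ` face_trace F S)"

(* (p, q) is a tree edge if some bisection splits p and q is one of the strictly
   smaller triangles replacing it. *)
definition trace_edges :: "marked_tet \<Rightarrow> point set \<Rightarrow> marked_triangle rel" where
  "trace_edges K F =
     {((G, fmark L G), (H, fmark L' H)) |L L' G H.
        L \<in> descendants K \<and> G \<in> faces L \<and> convex hull G \<subseteq> convex hull F \<and>
        L' \<in> children L \<and> H \<in> faces L' \<and> convex hull H \<subset> convex hull G}"

definition trace_tree ::
  "marked_tet \<Rightarrow> point set \<Rightarrow> marked_triangle set \<times> marked_triangle rel" where
  "trace_tree K F = (face_trace F (descendants K), trace_edges K F)"

(* The tree is infinite, and every node has exactly two successors. *)
definition binary_tree :: "'a \<Rightarrow> 'a set \<times> 'a rel \<Rightarrow> bool" where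
  "binary_tree r t \<longleftrightarrow> (case t of (N, E) \<Rightarrow>
     r \<in> N \<and> E \<subseteq> N \<times> N \<and>
     (\<forall>x\<in>N. (r, x) \<in> E\<^sup>*) \<and>
     (\<forall>p. (p, r) \<notin> E) \<and>
     (\<forall>x\<in>N - {r}. \<exists>!p. (p, x) \<in> E) \<and>
     (\<forall>x\<in>N. card (E `` {x}) = 2))"

definition halves :: "point set \<Rightarrow> point set \<Rightarrow> point set set" where
  "halves G e = (\<lambda>a. insert (mid e) (G - {a})) ` e"

(* The unbisected descendants of K after n bisections, where the i-th bisection is
   applied to L i. *)
primrec stage :: "marked_tet \<Rightarrow> (nat \<Rightarrow> marked_tet) \<Rightarrow> nat \<Rightarrow> marked_tet set" where
  "stage K L 0 = {K}"
| "stage K L (Suc n) = (stage K L n - {L n}) \<union> children (L n)"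

definition bisection_history :: "marked_tet \<Rightarrow> (nat \<Rightarrow> marked_tet) \<Rightarrow> nat \<Rightarrow> bool" where
  "bisection_history K L n \<longleftrightarrow> (\<forall>i<n. L i \<in> stage K L i)"

definition introduces :: "marked_tet \<Rightarrow> point set \<Rightarrow> point \<Rightarrow> bool" where
  "introduces L G v \<longleftrightarrow> G \<in> faces L \<and> v \<in> trace_vertices G (children L) - G"

(* Creation is understood within the triangulation of F: v may already have been a
   vertex of a descendant of K that meets F only in an edge. *)
definition created_at ::
  "marked_tet \<Rightarrow> point set \<Rightarrow> (nat \<Rightarrow> marked_tet) \<Rightarrow> nat \<Rightarrow> point \<Rightarrow> bool" where
  "created_at K F L i v \<longleftrightarrow>
     v \<notin> trace_vertices F (stage K L i) \<and> v \<in> trace_vertices F (stage K L (Suc i))"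

end

theory Submission
  imports Defs
begin

text \<open>
  Bisecting a marked tetrahedron through a face that contains the refinement edge halves this
  face at the midpoint of its mark and marks both halves opposite that midpoint; a face that does
  not contain the refinement edge survives with its mark, and this mark is the next refinement edge
  above it.  So the triangles traced on \<open>F\<close> arise from \<open>(F, \<mu>)\<close> by one planar rule.  New faces never
  lie in \<open>F\<close>, because \<open>F\<close> is a face of the convex body \<open>K\<close>: if the midpoint of an edge is in \<open>F\<close>,
  then so are its endpoints.  Two halves of a triangle meet only in a segment, so no triangle is
  reached along two different branches.
\<close>

section \<open>Bisection of marked triangles\<close>

text \<open>The ambient tetrahedron decides when a traced triangle is split, but not how: its type
  and flag enter the marking rules only through the mark of the common new face (and through later
  flags). They still matter indirectly. The planar rule can be iterated only if every descendant is
  again a marked tetrahedron, so that a face containing the refinement edge is marked by it. For the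
  common new face this depends on the type, which is why coplanar marks have to be analysed. The
  comparison has two directions: no triangle outside the planar tree is traced, and every node of
  the planar tree really occurs, even where the ambient bisections postpone its splitting.\<close>

definition bisections :: "marked_triangle \<Rightarrow> marked_triangle set" where
  "bisections p = (\<lambda>b. (insert (mid (snd p)) (fst p - {b}), fst p - {b})) ` snd p"

definition bisection_rel :: "marked_triangle rel" where
  "bisection_rel = {(p, q). q \<in> bisections p}"

text \<open>A function of the marked triangle alone, to serve as the witness for the tree in the
  theorem. Its edges are restricted to nodes reachable from \<open>r\<close>, so that every node but
  the root can have exactly one parent inside the tree.\<close>

definition intrinsic_tree :: "marked_triangle \<Rightarrow> marked_triangle set \<times> marked_triangle rel" where
  "intrinsic_tree r =
     (bisection_rel\<^sup>* `` {r}, {(p, q). (r, p) \<in> bisection_rel\<^sup>* \<and> q \<in> bisections p})"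

definition nondegenerate :: "marked_triangle \<Rightarrow> bool" where
  "nondegenerate p \<longleftrightarrow>
     card (fst p) = 3 \<and> \<not> affine_dependent (fst p) \<and> snd p \<in> edges (fst p)"

section \<open>Midpoints of edges of affinely independent sets\<close>

lemma edgesE:
  assumes "e \<in> edges V" "b \<in> e"
  obtains a where "e = {a, b}" "a \<noteq> b" "a \<in> V" "b \<in> V" "mid e = midpoint a b"
proof -
  have e: "e \<subseteq> V" "card e = 2"
    using assms(1) by (auto simp: edges_def)
  then obtain x y where xy: "e = {x, y}" "x \<noteq> y"
    by (auto simp: card_2_iff)
  show thesis
  proof (cases "b = x")
    case True
    then show ?thesis
      using that[of y] e(1) xy mid_pair[of y x] by (auto simp: insert_commute)
  next
    case False
    then show ?thesis
      using that[of x] e(1) xy mid_pair[of x y] assms(2) by auto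
  qed
qed

text \<open>If \<open>e = {a, b}\<close>, then b = 2 mid(e) - a, so an affine set containing
  \<open>a\<close> and the midpoint also contains \<open>b\<close>.\<close>

lemma mid_notin_affine_hull:
  assumes "\<not> affine_dependent V" "e \<in> edges V" "b \<in> e"
  shows "mid e \<notin> affine hull (V - {b})"
proof
  assume m: "mid e \<in> affine hull (V - {b})"
  obtain a where a: "e = {a, b}" "a \<noteq> b" "a \<in> V" "b \<in> V" "mid e = midpoint a b"
    using edgesE assms(2,3) .
  have "2 *\<^sub>R mid e + (- 1) *\<^sub>R a \<in> affine hull (V - {b})"
    by (rule mem_affine[OF affine_affine_hull m]) (use a in \<open>auto intro: hull_inc\<close>)
  moreover have "2 *\<^sub>R mid e + (- 1) *\<^sub>R a = b"
    using a by (simp add: midpoint_def)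
  ultimately show False
    using assms(1) a(4) by (auto simp: affine_dependent_def)
qed

lemma mid_notin:
  assumes "\<not> affine_dependent V" "e \<in> edges V"
  shows "mid e \<notin> V"
proof
  assume m: "mid e \<in> V"
  have "e \<noteq> {}"
    using assms(2) by (auto simp: edges_def)
  then obtain b where b: "b \<in> e" by blast
  obtain a where a: "e = {a, b}" "a \<noteq> b" "a \<in> V" "b \<in> V" "mid e = midpoint a b"
    using edgesE assms(2) b .
  have "mid e \<notin> V - {a}" "mid e \<notin> V - {b}"
    using mid_notin_affine_hull[OF assms, of a] mid_notin_affine_hull[OF assms, of b] a(1)
    by (blast intro: hull_inc)+
  then show False
    using m a(2) by auto
qed

lemma mid_in_convex_hull:
  assumes "e \<in> edges V"
  shows "mid e \<in> convex hull V"
proof -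
  have "e \<noteq> {}"
    using assms by (auto simp: edges_def)
  then obtain b where "b \<in> e" by blast
  then obtain a where a: "a \<in> V" "b \<in> V" "mid e = midpoint a b"
    using edgesE assms by metis
  have "closed_segment a b \<subseteq> convex hull V"
    using a by (intro closed_segment_subset) (auto intro: hull_inc)
  then show ?thesis
    using a(3) by (metis midpoint_in_closed_segment subsetD)
qed

lemma mid_insert_independent:
  assumes "\<not> affine_dependent V" "e \<in> edges V" "b \<in> e"
  shows "\<not> affine_dependent (insert (mid e) (V - {b}))"
  using assms affine_independent_insert mid_notin_affine_hull affine_independent_Diff by metis

lemma mid_insert_card:
  assumes "\<not> affine_dependent V" "e \<in> edges V" "b \<in> e"
  shows "card (insert (mid e) (V - {b})) = card V"
proof -
  have "finite V" "b \<in> V"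
    using assms by (auto simp: edges_def aff_independent_finite)
  then show ?thesis
    using mid_notin[OF assms(1,2)] card.remove[of V b] by simp
qed

text \<open>A vertex of \<open>H\<close> outside \<open>G\<close> would be an affine combination of
  the other vertices. This turns geometric inclusion between faces of one tetrahedron into inclusion
  of vertex sets.\<close>

lemma independent_hull_subset:
  assumes "\<not> affine_dependent V" "H \<subseteq> V" "G \<subseteq> V" "convex hull H \<subseteq> convex hull G"
  shows "H \<subseteq> G"
proof
  fix v assume v: "v \<in> H"
  show "v \<in> G"
  proof (rule ccontr)
    assume "v \<notin> G"
    then have "G \<subseteq> V - {v}" using assms(3) by auto
    have "v \<in> convex hull G" using v assms(4) by (auto intro: hull_inc)
    then have "v \<in> affine hull (V - {v})"
      using convex_hull_subset_affine_hull[of G] hull_mono[OF \<open>G \<subseteq> V - {v}\<close>, of affine] by blast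
    then show False
      using assms(1,2) v by (auto simp: affine_dependent_def)
  qed
qed

section \<open>Bisection preserves nondegeneracy and strictly shrinks triangles\<close>

lemma fst_bisections: "fst ` bisections (G, \<mu>) = halves G \<mu>"
  by (simp add: bisections_def halves_def image_image)

lemma nondegenerate_bisections:
  assumes "nondegenerate p" "q \<in> bisections p"
  shows "nondegenerate q"
proof -
  obtain b where b: "b \<in> snd p" "q = (insert (mid (snd p)) (fst p - {b}), fst p - {b})"
    using assms(2) by (auto simp: bisections_def)
  have p: "card (fst p) = 3" "\<not> affine_dependent (fst p)" "snd p \<in> edges (fst p)"
    using assms(1) by (auto simp: nondegenerate_def)
  have "b \<in> fst p"
    using p(3) b(1) by (auto simp: edges_def)
  then have "card (fst p - {b}) = 2"
    using p(1) by simp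
  then show ?thesis
    using b(2) mid_insert_card[OF p(2,3) b(1)] mid_insert_independent[OF p(2,3) b(1)] p(1)
    by (auto simp: nondegenerate_def edges_def)
qed

text \<open>Inclusion is strict because the extreme points of a nondegenerate triangle are its
  vertices: equal hulls would have equal vertex sets, but the midpoint is a vertex of the half only.
  This strictness later excludes cycles in the tree.\<close>

lemma convex_hull_bisections:
  assumes "nondegenerate p" "q \<in> bisections p"
  shows "convex hull (fst q) \<subset> convex hull (fst p)"
proof -
  obtain b where b: "b \<in> snd p" "q = (insert (mid (snd p)) (fst p - {b}), fst p - {b})"
    using assms(2) by (auto simp: bisections_def)
  have p: "\<not> affine_dependent (fst p)" "snd p \<in> edges (fst p)"
    using assms(1) by (auto simp: nondegenerate_def)
  have "fst q \<subseteq> convex hull (fst p)"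
    using b(2) mid_in_convex_hull[OF p(2)] by (auto intro: hull_inc)
  then have "convex hull (fst q) \<subseteq> convex hull (fst p)"
    by (simp add: hull_minimal)
  moreover have "convex hull (fst q) \<noteq> convex hull (fst p)"
  proof
    assume eq: "convex hull (fst q) = convex hull (fst p)"
    have q: "\<not> affine_dependent (fst q)"
      using nondegenerate_bisections[OF assms] by (simp add: nondegenerate_def)
    have "x \<in> fst q \<longleftrightarrow> x \<in> fst p" for x
      using extreme_point_of_convex_hull_affine_independent[OF p(1), of x]
        extreme_point_of_convex_hull_affine_independent[OF q, of x] eq by simp
    then have "fst q = fst p" by blast
    then show False
      using mid_notin[OF p] b(2) by auto
  qed
  ultimately show ?thesis by blast
qed

lemma convex_hull_bisections_rtrancl:
  assumes "(p, q) \<in> bisection_rel\<^sup>*" "nondegenerate p"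
  shows "nondegenerate q \<and> convex hull (fst q) \<subseteq> convex hull (fst p)"
  using assms(1)
proof induction
  case (step y z)
  then have "nondegenerate y" "z \<in> bisections y"
    by (simp_all add: bisection_rel_def)
  then show ?case
    using nondegenerate_bisections convex_hull_bisections step.IH by blast
qed (use assms(2) in simp)

lemma convex_hull_bisections_trancl:
  assumes "(p, q) \<in> bisection_rel\<^sup>+" "nondegenerate p"
  shows "convex hull (fst q) \<subset> convex hull (fst p)"
proof -
  obtain s where s: "s \<in> bisections p" "(s, q) \<in> bisection_rel\<^sup>*"
    using tranclD[OF assms(1)] by (auto simp: bisection_rel_def)
  have "nondegenerate s" "convex hull (fst s) \<subset> convex hull (fst p)"
    using s(1) assms(2) nondegenerate_bisections convex_hull_bisections by blast+
  then show ?thesis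
    using convex_hull_bisections_rtrancl[OF s(2)] by blast
qed

lemma card_bisections:
  assumes "nondegenerate p"
  shows "card (bisections p) = 2"
proof -
  have "snd p \<subseteq> fst p" "card (snd p) = 2"
    using assms by (auto simp: nondegenerate_def edges_def)
  moreover from this have "inj_on (\<lambda>b. (insert (mid (snd p)) (fst p - {b}), fst p - {b})) (snd p)"
    by (auto simp: inj_on_def)
  ultimately show ?thesis
    by (simp add: bisections_def card_image)
qed

text \<open>Comparing the barycentric coordinates of \<open>x\<close> with respect to
  \<open>a\<close>, \<open>b\<close>, \<open>c\<close> in its two representations shows that the
  weight of \<open>a\<close> in the first one vanishes, which leaves a point of the common
  line.\<close>

lemma halves_intersection:
  fixes a b c x :: "'a::real_vector"
  assumes indep: "\<not> affine_dependent {a, b, c}" and d: "a \<noteq> b" "a \<noteq> c" "b \<noteq> c"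
    and x1: "x \<in> convex hull {midpoint a b, a, c}"
    and x2: "x \<in> convex hull {midpoint a b, b, c}"
  shows "x \<in> affine hull {midpoint a b, c}"
proof -
  obtain s t u where 1: "0 \<le> s" "0 \<le> t" "0 \<le> u" "s + t + u = 1"
      "x = s *\<^sub>R midpoint a b + t *\<^sub>R a + u *\<^sub>R c"
    using x1 unfolding convex_hull_3 by blast
  obtain s' t' u' where 2: "0 \<le> s'" "0 \<le> t'" "0 \<le> u'" "s' + t' + u' = 1"
      "x = s' *\<^sub>R midpoint a b + t' *\<^sub>R b + u' *\<^sub>R c"
    using x2 unfolding convex_hull_3 by blast
  \<comment> \<open>These are the differences of the coordinates of \<open>x\<close> at
    \<open>a\<close>, \<open>b\<close>, \<open>c\<close> after the midpoint has been expanded;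
    affine independence makes them vanish.\<close>
  define A B C where "A = s/2 + t - s'/2" and "B = s/2 - s'/2 - t'" and "C = u - u'"
  define U where "U = (\<lambda>v. if v = a then A else if v = b then B else C)"
  have "A *\<^sub>R a + B *\<^sub>R b + C *\<^sub>R c = x - x"
    by (subst (2) 2(5), subst 1(5))
       (simp add: A_def B_def C_def midpoint_def algebra_simps)
  moreover have "A + B + C = 0"
    using 1(4) 2(4) by (simp add: A_def B_def C_def)
  ultimately have "sum U {a, b, c} = 0" "(\<Sum>v\<in>{a, b, c}. U v *\<^sub>R v) = 0"
    using d by (auto simp: U_def algebra_simps)
  then have "\<forall>v\<in>{a, b, c}. U v = 0"
    using indep affine_dependent_explicit_finite[of "{a, b, c}"] by blast
  then have "A = 0" "B = 0"
    using d by (auto simp: U_def)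
  \<comment> \<open>\<open>A = 0\<close> and \<open>B = 0\<close> together give t = -t', and both
    weights are nonnegative.\<close>
  then have "t = 0"
    using 1(2) 2(2) by (simp add: A_def B_def)
  then show ?thesis
    using 1 unfolding affine_hull_2 by auto
qed

text \<open>The two halves meet within a line, whereas a nondegenerate triangle has affine dimension
  2.\<close>

lemma bisections_disjoint:
  assumes p: "nondegenerate p" and q: "q \<in> bisections p" "q' \<in> bisections p" "q \<noteq> q'"
    and X: "convex hull (fst x) \<subseteq> convex hull (fst q)" "convex hull (fst x) \<subseteq> convex hull (fst q')"
  shows "\<not> nondegenerate x"
proof
  assume x: "nondegenerate x"
  have G: "card (fst p) = 3" "\<not> affine_dependent (fst p)" "snd p \<in> edges (fst p)"
    using p by (auto simp: nondegenerate_def)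
  obtain b where b: "b \<in> snd p" "q = (insert (mid (snd p)) (fst p - {b}), fst p - {b})"
    using q(1) by (auto simp: bisections_def)
  obtain a where a: "snd p = {a, b}" "a \<noteq> b" "a \<in> fst p" "b \<in> fst p" "mid (snd p) = midpoint a b"
    using edgesE G(3) b(1) .
  have q': "q' = (insert (mid (snd p)) (fst p - {a}), fst p - {a})"
    using q a(1) b(2) by (auto simp: bisections_def)
  have "card (fst p - {a, b}) = 1"
    using G(1) a by (simp add: card_Diff_subset)
  then obtain c where "fst p - {a, b} = {c}"
    by (auto simp: card_1_singleton_iff)
  then have c: "fst p = {a, b, c}" "a \<noteq> c" "b \<noteq> c"
    using a by auto
  have fst: "fst q = {midpoint a b, a, c}" "fst q' = {midpoint a b, b, c}"
    using b(2) q' a(2,5) c by auto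
  have "convex hull (fst x) \<subseteq> affine hull {midpoint a b, c}"
  proof
    fix y assume "y \<in> convex hull (fst x)"
    then have "y \<in> convex hull {midpoint a b, a, c}" "y \<in> convex hull {midpoint a b, b, c}"
      using X fst by auto
    then show "y \<in> affine hull {midpoint a b, c}"
      using halves_intersection[of a b c y] G(2) c a(2) by simp
  qed
  then have "fst x \<subseteq> affine hull {midpoint a b, c}"
    using hull_subset[of "fst x" convex] by blast
  then have "aff_dim (fst x) \<le> aff_dim {midpoint a b, c}"
    by (metis aff_dim_affine_hull aff_dim_subset)
  also have "\<dots> \<le> 1"
    by (simp add: aff_dim_2)
  finally show False
    using x aff_dim_affine_independent[of "fst x"] by (auto simp: nondegenerate_def)
qed

lemma bisections_common_descendant:
  assumes "nondegenerate p" "q \<in> bisections p" "q' \<in> bisections p"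
    and "(q, x) \<in> bisection_rel\<^sup>*" "(q', x) \<in> bisection_rel\<^sup>*"
  shows "q = q'"
proof (rule ccontr)
  assume "q \<noteq> q'"
  have "nondegenerate q" "nondegenerate q'"
    using nondegenerate_bisections assms by auto
  then show False
    using bisections_disjoint[OF assms(1-3) \<open>q \<noteq> q'\<close>] convex_hull_bisections_rtrancl assms(4,5)
    by blast
qed

text \<open>Ancestors of one node lie on a single branch. Follow the path from \<open>r\<close> to
  \<open>p\<close>: as long as the current node lies strictly above \<open>q\<close>, its successor
  towards \<open>q\<close> and its successor towards \<open>p\<close> both lead to \<open>x\<close>,
  so they coincide.\<close>

lemma bisection_rel_comparable:
  assumes "(r, p) \<in> bisection_rel\<^sup>*" "(p, x) \<in> bisection_rel\<^sup>*" "nondegenerate r"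
    and "(r, q) \<in> bisection_rel\<^sup>*" "(q, x) \<in> bisection_rel\<^sup>*"
  shows "(p, q) \<in> bisection_rel\<^sup>* \<or> (q, p) \<in> bisection_rel\<^sup>*"
  using assms(1,2)
proof (induction rule: rtrancl_induct)
  case base
  show ?case using assms(4) by simp
next
  case (step p' p)
  have p': "nondegenerate p'"
    using convex_hull_bisections_rtrancl[OF step(1)] assms(3) by blast
  have "(p', q) \<in> bisection_rel\<^sup>* \<or> (q, p') \<in> bisection_rel\<^sup>*"
    by (rule step.IH) (rule converse_rtrancl_into_rtrancl[OF step.hyps(2) step.prems])
  then consider "(q, p') \<in> bisection_rel\<^sup>*"
    | s where "(p', s) \<in> bisection_rel" "(s, q) \<in> bisection_rel\<^sup>*"
  proof
    assume "(p', q) \<in> bisection_rel\<^sup>*"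
    then show thesis
      using that by (cases rule: converse_rtranclE) simp_all
  qed (rule that)
  then show ?case
  proof cases
    case 1
    then show ?thesis using step.hyps(2) by (blast intro: rtrancl_into_rtrancl)
  next
    case (2 s)
    then have "s = p"
      using bisections_common_descendant[OF p', of s p x] step.hyps(2) step.prems
        rtrancl_trans[OF 2(2) assms(5)] by (simp add: bisection_rel_def)
    then show ?thesis using 2 by blast
  qed
qed

lemma bisection_rel_unique_parent:
  assumes "nondegenerate r" "(r, p) \<in> bisection_rel\<^sup>*" "(r, q) \<in> bisection_rel\<^sup>*"
    and "x \<in> bisections p" "x \<in> bisections q"
  shows "p = q"
proof -
  have no: "p = q"
    if pq: "(p, q) \<in> bisection_rel\<^sup>*" and "nondegenerate p" "x \<in> bisections p" "x \<in> bisections q" for p q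
  proof (rule ccontr)
    assume "p \<noteq> q"
    obtain s where "(p, s) \<in> bisection_rel" "(s, q) \<in> bisection_rel\<^sup>*"
      using pq
    proof (cases rule: converse_rtranclE)
      case base
      with \<open>p \<noteq> q\<close> show thesis by simp
    next
      case (step s)
      then show thesis by (rule that)
    qed
    then have s: "s \<in> bisections p" "(s, q) \<in> bisection_rel\<^sup>*"
      by (simp_all add: bisection_rel_def)
    have qx: "(q, x) \<in> bisection_rel"
      using that(4) by (simp add: bisection_rel_def)
    \<comment> \<open>Both are halves of \<open>p\<close> having \<open>x\<close> as a descendant,
      \<open>s\<close> by way of \<open>q\<close>. As \<open>q\<close> has \<open>x\<close> as a
      half, this closes a cycle at \<open>x\<close>, contrary to strict shrinking.\<close>
    have "s = x"
      by (rule bisections_common_descendant[OF that(2) s(1) that(3), of x]) (use s(2) qx in auto)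
    then have "(x, x) \<in> bisection_rel\<^sup>+"
      using s(2) qx by auto
    then show False
      using convex_hull_bisections_trancl nondegenerate_bisections[OF that(2,3)] by blast
  qed
  have "(p, x) \<in> bisection_rel\<^sup>*" "(q, x) \<in> bisection_rel\<^sup>*"
    using assms(4,5) by (auto simp: bisection_rel_def)
  then have "(p, q) \<in> bisection_rel\<^sup>* \<or> (q, p) \<in> bisection_rel\<^sup>*"
    using bisection_rel_comparable assms(1-3) by blast
  moreover have "nondegenerate p" "nondegenerate q"
    using convex_hull_bisections_rtrancl assms(1-3) by blast+
  ultimately show ?thesis
    using no[of p q] no[of q p] assms(4,5) by blast
qed

lemma binary_tree_intrinsic_tree:
  assumes "nondegenerate r"
  shows "binary_tree r (intrinsic_tree r)"
proof -
  define N where "N = bisection_rel\<^sup>* `` {r}"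
  define E where "E = {(p, q). (r, p) \<in> bisection_rel\<^sup>* \<and> q \<in> bisections p}"
  have nondeg: "nondegenerate p" if "p \<in> N" for p
    using that convex_hull_bisections_rtrancl assms unfolding N_def by blast
  have E: "(p, q) \<in> E \<longleftrightarrow> p \<in> N \<and> (p, q) \<in> bisection_rel" for p q
    by (auto simp: E_def N_def bisection_rel_def)
  have "r \<in> N"
    by (simp add: N_def)
  moreover have "E \<subseteq> N \<times> N"
    by (auto simp: E N_def)
  moreover have "(r, x) \<in> E\<^sup>*" if "x \<in> N" for x
  proof -
    have "(r, x) \<in> bisection_rel\<^sup>*" using that by (simp add: N_def)
    then show ?thesis
    proof induction
      case (step y z)
      then have "(y, z) \<in> E" by (simp add: E N_def)
      then show ?case using step.IH by auto
    qed simp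
  qed
  moreover have "(p, r) \<notin> E" for p
  proof
    assume "(p, r) \<in> E"
    then have "(r, r) \<in> bisection_rel\<^sup>+"
      by (auto simp: E N_def)
    then show False
      using convex_hull_bisections_trancl assms by blast
  qed
  moreover have "\<exists>!p. (p, x) \<in> E" if x: "x \<in> N - {r}" for x
  proof (rule ex_ex1I)
    have "(r, x) \<in> bisection_rel\<^sup>*" "x \<noteq> r" using x by (auto simp: N_def)
    then obtain p where "(r, p) \<in> bisection_rel\<^sup>*" "(p, x) \<in> bisection_rel"
      by (metis rtranclE)
    then have "(p, x) \<in> E"
      by (simp add: E N_def)
    then show "\<exists>p. (p, x) \<in> E" ..
  next
    fix p q assume "(p, x) \<in> E" "(q, x) \<in> E"
    then show "p = q"
      using bisection_rel_unique_parent[OF assms, of p q x] by (simp add: E_def)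
  qed
  moreover have "card (E `` {x}) = 2" if "x \<in> N" for x
  proof -
    have "E `` {x} = bisections x"
      using that by (auto simp: E_def N_def)
    then show ?thesis
      using card_bisections nondeg that by simp
  qed
  ultimately have "binary_tree r (N, E)"
    unfolding binary_tree_def by simp
  then show ?thesis
    by (simp add: intrinsic_tree_def N_def E_def)
qed

section \<open>Bisection of marked tetrahedra\<close>

lemma marked_tetrahedronD:
  assumes "marked_tetrahedron K"
  shows "card (verts K) = 4" "\<not> affine_dependent (verts K)" "redge K \<in> edges (verts K)"
    "redge K \<subseteq> verts K" "card (redge K) = 2" "finite (verts K)"
    "mid (redge K) \<notin> verts K"
    "F \<in> faces K \<Longrightarrow> fmark K F \<in> edges F"
    "F \<in> faces K \<Longrightarrow> redge K \<subseteq> F \<Longrightarrow> fmark K F = redge K"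
  using assms mid_notin
  by (auto simp: marked_tetrahedron_def edges_def intro: aff_independent_finite)

lemma verts_child: "verts (child K b) = insert (mid (redge K)) (verts K - {b})"
  and redge_child: "redge (child K b) = fmark K (verts K - {b})"
  and fmark_child: "fmark (child K b) = child_mark K"
  and flag_child: "flag (child K b) = type_Pu K"
  by (simp_all add: child_def child_redge_def)

lemma facesD:
  assumes "F \<in> faces K"
  shows "F \<subseteq> verts K" "card F = 3" "finite F"
  using assms by (auto simp: faces_def triangles_def intro: card_ge_0_finite)

lemma opposite_face:
  assumes "marked_tetrahedron K" "b \<in> verts K"
  shows "verts K - {b} \<in> faces K"
  using marked_tetrahedronD[OF assms(1)] assms(2) by (simp add: faces_def triangles_def)

lemma face_subset_eq:
  assumes "F \<in> faces K" "G \<in> faces L" "F \<subseteq> G"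
  shows "F = G"
  using facesD[OF assms(1)] facesD[OF assms(2)] assms(3) by (simp add: card_subset_eq)

text \<open>Two questions decide the case: whether \<open>F\<close> contains the midpoint, and
  whether it contains the surviving endpoint \<open>a\<close> of the refinement edge. If it contains
  both, the face it was cut from is recovered by replacing the midpoint with
  \<open>b\<close>.\<close>

lemma child_face_cases:
  assumes K: "marked_tetrahedron K" and b: "b \<in> redge K" and F: "F \<in> faces (child K b)"
  obtains (inherited) "F = verts K - {b}" "F \<in> faces K" "child_mark K F = fmark K F"
  | (new) "F = new_face K" "child_mark K F = new_face_mark K"
  | (cut) G where "G \<in> faces K" "redge K \<subseteq> G" "F = insert (mid (redge K)) (G - {b})"
      "child_mark K F = G - {b}"
proof -
  note KD = marked_tetrahedronD[OF K]
  define m where "m = mid (redge K)"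
  have m: "m \<notin> verts K" using KD by (simp add: m_def)
  obtain a where a: "redge K = {a, b}" "a \<noteq> b" "a \<in> verts K" "b \<in> verts K"
    using edgesE KD(3) b by metis
  have Fsub: "F \<subseteq> insert m (verts K - {b})" "card F = 3" "finite F"
    using facesD[OF F] by (auto simp: verts_child m_def)
  have opp: "card (verts K - {b}) = 3" "card (verts K - {a, b}) = 2"
    using a KD(1) by (simp_all add: card_Diff_subset)
  show thesis
  proof (cases "m \<in> F")
    case False
    then have "F = verts K - {b}"
      using Fsub opp KD(6) by (intro card_subset_eq) auto
    then show ?thesis
      using inherited opposite_face[OF K a(4)] by (simp add: child_mark_def)
  next
    case True
    then have notface: "F \<notin> faces K"
      using m facesD(1) by blast
    define Q where "Q = F - {m}"
    have Q: "F = insert m Q" "Q \<subseteq> verts K - {b}" "card Q = 2" "finite Q" "m \<notin> Q" "b \<notin> Q"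
      using True Fsub by (auto simp: Q_def)
    show ?thesis
    proof (cases "a \<in> Q")
      case False
      then have "Q = verts K - {a, b}"
        using Q opp KD(6) by (intro card_subset_eq) auto
      then have "F = new_face K"
        using Q(1) a(1) by (simp add: new_face_def m_def)
      then show ?thesis
        using new notface by (simp add: child_mark_def)
    next
      case True
      have "insert b Q \<in> faces K"
        using Q a(4) by (auto simp: faces_def triangles_def)
      moreover have "redge K \<subseteq> insert b Q"
        using True a(1) by simp
      moreover have "insert b Q - {b} = Q" "F - {m} = Q"
        using Q by auto
      moreover have "F \<noteq> new_face K"
      proof -
        have "a \<in> F" "a \<notin> new_face K"
          using True Q(1) a m by (auto simp: new_face_def m_def)
        then show ?thesis by blast
      qed
      ultimately show ?thesis
        using cut[of "insert b Q"] Q(1) notface by (simp add: child_mark_def m_def)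
    qed
  qed
qed

text \<open>Coplanar marks must miss some vertex \<open>u\<close>, since the four vertices span
  dimension 3. The refinement edge is itself a mark, so \<open>u\<close> is off it; let
  \<open>w\<close> be the other vertex off it. The face opposite \<open>b\<close> then has only
  \<open>a\<close> and \<open>w\<close> left as endpoints of its mark.\<close>

lemma type_P_common_endpoint:
  assumes K: "marked_tetrahedron K" and P: "type_P K"
  obtains w where "w \<in> verts K - redge K"
    "\<And>a b. redge K = {a, b} \<Longrightarrow> a \<noteq> b \<Longrightarrow> child_redge K b = {a, w}"
proof -
  note KD = marked_tetrahedronD[OF K]
  define U where "U = (\<Union>F\<in>faces K. fmark K F)"
  have "U \<subseteq> (\<Union>F\<in>faces K. convex hull (fmark K F))"
    by (auto simp: U_def intro: hull_inc)
  moreover obtain x y z where "(\<Union>F\<in>faces K. convex hull (fmark K F)) \<subseteq> affine hull {x, y, z}"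
    using P unfolding type_P_def coplanar_def by blast
  ultimately have xyz: "U \<subseteq> affine hull {x, y, z}"
    by (rule order_trans)
  have "\<not> verts K \<subseteq> U"
  proof
    assume "verts K \<subseteq> U"
    then have "aff_dim (verts K) \<le> aff_dim {x, y, z}"
      using xyz by (metis aff_dim_affine_hull aff_dim_subset order_trans)
    also have "\<dots> \<le> int (card {x, y, z}) - 1"
      by (rule aff_dim_le_card) simp
    also have "\<dots> \<le> 2"
      using card_insert_le_m1[of 3 "{y, z}" x] card_insert_le_m1[of 2 "{z}" y] by simp
    finally show False
      using aff_dim_affine_independent[OF KD(2)] KD(1) by simp
  qed
  then obtain u where u: "u \<in> verts K" "u \<notin> U" by blast
  have mark: "u \<notin> fmark K F" if "F \<in> faces K" for F
    using u that by (auto simp: U_def)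
  obtain c where "c \<in> redge K"
    using KD(5) by fastforce
  then obtain d where d: "redge K = {d, c}" "d \<noteq> c" "d \<in> verts K" "c \<in> verts K"
    using edgesE KD(3) by metis
  have "card (verts K - {d, c}) = 2"
    using d KD(1) by (simp add: card_Diff_subset)
  have "\<exists>F\<in>faces K. redge K \<subseteq> F"
  proof -
    obtain v where "v \<in> verts K - {d, c}"
      using \<open>card (verts K - {d, c}) = 2\<close>
      by (metis all_not_in_conv card.empty zero_neq_numeral)
    then have "insert v {d, c} \<in> faces K"
      using d by (auto simp: faces_def triangles_def)
    then show ?thesis using d(1) by blast
  qed
  then have "u \<notin> redge K"
    using mark KD(9) by metis
  then have "card (verts K - {d, c} - {u}) = 1"
    using \<open>card (verts K - {d, c}) = 2\<close> u(1) d(1) by simp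
  then obtain w where w: "verts K - {d, c} - {u} = {w}"
    by (auto simp: card_1_singleton_iff)
  show thesis
  proof (rule that)
    show "w \<in> verts K - redge K"
      using w d(1) by auto
  next
    fix a b assume ab: "redge K = {a, b}" "a \<noteq> b"
    have b: "b \<in> verts K" using KD(4) ab by auto
    have F: "verts K - {b} \<in> faces K"
      by (rule opposite_face[OF K b])
    have "fmark K (verts K - {b}) \<subseteq> verts K - {b} - {u}" "card (fmark K (verts K - {b})) = 2"
      using KD(8)[OF F] mark[OF F] by (auto simp: edges_def)
    moreover have "verts K - {b} - {u} \<subseteq> {a, w}"
      using w d(1) ab(1) by auto
    ultimately have "fmark K (verts K - {b}) \<subseteq> {a, w}" "card (fmark K (verts K - {b})) = 2"
      by auto
    then show "child_redge K b = {a, w}"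
      unfolding child_redge_def
      by (intro card_subset_eq) (use w d(1) ab in auto)
  qed
qed

lemma new_face_mark_cases:
  assumes K: "marked_tetrahedron K"
  obtains (f) w where "type_Pf K" "w \<in> verts K - redge K"
      "new_face_mark K = {mid (redge K), w}"
      "\<And>a b. redge K = {a, b} \<Longrightarrow> a \<noteq> b \<Longrightarrow> child_redge K b = {a, w}"
  | (u) "\<not> type_Pf K" "new_face_mark K = verts K - redge K"
proof (cases "type_Pf K")
  case True
  note KD = marked_tetrahedronD[OF K]
  obtain w where w: "w \<in> verts K - redge K"
      "\<And>a b. redge K = {a, b} \<Longrightarrow> a \<noteq> b \<Longrightarrow> child_redge K b = {a, w}"
    using type_P_common_endpoint K True by (metis type_Pf_def)
  obtain x y where xy: "redge K = {x, y}" "x \<noteq> y"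
    using KD(5) by (auto simp: card_2_iff)
  have "child_redge K y = {x, w}" "child_redge K x = {y, w}"
    using w(2) xy by (auto simp: insert_commute)
  \<comment> \<open>The child refinement edges {x, w} and {y, w} share only \<open>w\<close>, so the
    description in \<open>new_face_mark\<close> is well defined.\<close>
  then have "(THE w. w \<in> verts K - redge K \<and> (\<forall>b\<in>redge K. w \<in> child_redge K b)) = w"
    using w(1) xy by (intro the_equality) auto
  then show ?thesis
    using f True w by (simp add: new_face_mark_def)
next
  case False
  then show ?thesis
    using u by (simp add: new_face_mark_def)
qed

section \<open>Descendants are marked tetrahedra\<close>

lemma marked_tetrahedron_child:
  assumes K: "marked_tetrahedron K" and b: "b \<in> redge K"
  shows "marked_tetrahedron (child K b)"
proof -
  note KD = marked_tetrahedronD[OF K]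
  define m where "m = mid (redge K)"
  have m: "m \<notin> verts K" using KD by (simp add: m_def)
  obtain a where a: "redge K = {a, b}" "a \<noteq> b" "a \<in> verts K" "b \<in> verts K"
    using edgesE KD(3) b by metis
  have two: "card (verts K - redge K) = 2"
    using a KD(1) by (simp add: card_Diff_subset)
  have F0: "verts K - {b} \<in> faces K"
    by (rule opposite_face[OF K a(4)])
  have r: "child_redge K b \<subseteq> verts K - {b}" "card (child_redge K b) = 2"
    using KD(8)[OF F0] by (auto simp: child_redge_def edges_def)
  \<comment> \<open>The third clause is the delicate one. In type \<open>P_f\<close> the child
    refinement edge contains the endpoint \<open>a\<close>, so it is not in the new face. In the
    other types, and for cut faces, a child refinement edge inside the face avoids the midpoint;
    hence it is the edge opposite the midpoint, which is exactly the mark.\<close>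
  have sub: "child_mark K F \<subseteq> F \<and> card (child_mark K F) = 2 \<and>
      (child_redge K b \<subseteq> F \<longrightarrow> child_mark K F = child_redge K b) \<and>
      (type_Pu K \<longrightarrow> child_mark K F \<subseteq> verts K - {b})"
    if F: "F \<in> faces (child K b)" for F
    using K b F
  proof (cases rule: child_face_cases)
    case inherited
    then show ?thesis
      using KD(8)[OF inherited(2)] by (auto simp: edges_def child_redge_def)
  next
    case new
    have nf: "new_face K = insert m (verts K - redge K)"
      by (simp add: new_face_def m_def)
    show ?thesis
      using K
    proof (cases rule: new_face_mark_cases)
      case (f w)
      have "child_redge K b = {a, w}" using f(4) a by blast
      then have "\<not> child_redge K b \<subseteq> F"
        using new nf a(1,3) m by auto
      moreover have "card {m, w} = 2" using f(2) m by (auto simp: card_2_iff)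
      moreover have "\<not> type_Pu K" using f(1) by (simp add: type_Pf_def type_Pu_def)
      ultimately show ?thesis
        using new f nf by (simp add: m_def)
    next
      case u
      have "child_redge K b = verts K - redge K" if "child_redge K b \<subseteq> F"
      proof (rule card_subset_eq)
        show "child_redge K b \<subseteq> verts K - redge K"
          using that r(1) m new(1) nf by auto
      qed (use two r KD(6) in auto)
      then show ?thesis
        using new u nf two b by auto
    qed
  next
    case (cut G)
    have G: "card (G - {b}) = 2" "G \<subseteq> verts K" "finite G"
      using facesD[OF cut(1)] cut(2) b by auto
    have "child_redge K b = G - {b}" if "child_redge K b \<subseteq> F"
      by (rule card_subset_eq) (use that r m cut(3) G in \<open>auto simp: m_def\<close>)
    then show ?thesis
      using cut G by auto
  qed
  \<comment> \<open>A child is flagged only if \<open>K\<close> has type \<open>P_u\<close>; then no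
    mark of the child uses the midpoint, so all of them lie in the plane of the inherited
    face.\<close>
  have cop: "coplanar (\<Union>F\<in>faces (child K b). convex hull (child_mark K F))" if "type_Pu K"
  proof -
    have "convex hull (child_mark K F) \<subseteq> affine hull (verts K - {b})"
      if "F \<in> faces (child K b)" for F
      using sub[OF that] \<open>type_Pu K\<close>
      by (meson convex_hull_subset_affine_hull hull_mono order_trans)
    moreover obtain x y z where "verts K - {b} = {x, y, z}"
      using facesD(2)[OF F0] by (auto simp: card_3_iff)
    ultimately show ?thesis
      unfolding coplanar_def by (metis UN_least)
  qed
  show ?thesis
    unfolding marked_tetrahedron_def redge_child fmark_child flag_child
    using mid_insert_card[OF KD(2,3) b] mid_insert_independent[OF KD(2,3) b] KD(1) r sub cop
    by (auto simp: verts_child edges_def child_redge_def[symmetric])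
qed

lemma verts_child_subset:
  assumes "marked_tetrahedron K"
  shows "verts (child K b) \<subseteq> convex hull (verts K)"
  using mid_in_convex_hull[OF marked_tetrahedronD(3)[OF assms]]
  by (auto simp: verts_child intro: hull_inc)

lemma descendants_refl: "K \<in> descendants K"
  by (simp add: descendants_def)

lemma descendants_children:
  "L \<in> descendants K \<Longrightarrow> L' \<in> children L \<Longrightarrow> L' \<in> descendants K"
  by (auto simp: descendants_def intro: rtrancl_into_rtrancl)

lemma descendants_induct [consumes 1, case_names base step]:
  assumes "L \<in> descendants K" "P K"
    and "\<And>L L'. L \<in> descendants K \<Longrightarrow> P L \<Longrightarrow> L' \<in> children L \<Longrightarrow> P L'"
  shows "P L"
proof -
  have "(K, L) \<in> {(A, B). B \<in> children A}\<^sup>*"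
    using assms(1) by (simp add: descendants_def)
  then show ?thesis
  proof induction
    case (step y z)
    then show ?case
      using assms(3)[of y z] by (simp add: descendants_def)
  qed (rule assms(2))
qed

lemma descendants_props:
  assumes "L \<in> descendants K" "marked_tetrahedron K"
  shows "marked_tetrahedron L \<and> verts L \<subseteq> convex hull (verts K)"
  using assms(1)
proof (induction rule: descendants_induct)
  case base
  then show ?case using assms(2) by (simp add: hull_subset)
next
  case (step L L')
  then obtain b where "b \<in> redge L" "L' = child L b"
    by (auto simp: children_def)
  moreover have "convex hull (verts L) \<subseteq> convex hull (verts K)"
    using step by (simp add: hull_minimal)
  ultimately show ?case
    using step marked_tetrahedron_child verts_child_subset by blast
qed

section \<open>Traces on a face\<close>

lemma face_trace_iff:
  "(H, \<nu>) \<in> face_trace F S \<longleftrightarrow>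
    (\<exists>L\<in>S. H \<in> faces L \<and> convex hull H \<subseteq> convex hull F \<and> \<nu> = fmark L H)"
  by (auto simp: face_trace_def)

lemma face_trace_Un: "face_trace F (S \<union> S') = face_trace F S \<union> face_trace F S'"
  by (auto simp: face_trace_def)

lemma face_trace_mono: "S \<subseteq> S' \<Longrightarrow> face_trace F S \<subseteq> face_trace F S'"
  by (auto simp: face_trace_def)

text \<open>Here \<open>F\<close> is a convex face of a body \<open>D\<close>, not a vertex set. The
  generality serves two uses: a face of \<open>L\<close> itself, and a face of the original
  tetrahedron of which \<open>L\<close> is a descendant. The new face drops out because it also
  contains both vertices off the refinement edge, so all of \<open>L\<close> would lie in
  \<open>F\<close>.\<close>

lemma child_face_in_face:
  assumes L: "marked_tetrahedron L" and b: "b \<in> redge L" and H: "H \<in> faces (child L b)"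
    and F: "F face_of D" "verts L \<subseteq> D" "\<not> verts L \<subseteq> F" and HF: "convex hull H \<subseteq> F"
  obtains (inherited) "H = verts L - {b}" "H \<in> faces L" "child_mark L H = fmark L H"
  | (cut) G where "G \<in> faces L" "redge L \<subseteq> G" "convex hull G \<subseteq> F"
      "H = insert (mid (redge L)) (G - {b})" "child_mark L H = G - {b}"
proof -
  obtain a where a: "redge L = {a, b}" "a \<noteq> b" "a \<in> verts L" "b \<in> verts L"
      "mid (redge L) = midpoint a b"
    using edgesE marked_tetrahedronD(3)[OF L] b .
  have HF': "H \<subseteq> F"
    using HF hull_subset[of H convex] by blast
  have redge: "redge L \<subseteq> F" if "mid (redge L) \<in> H"
  proof -
    have "midpoint a b \<in> open_segment a b"
      using a(2) by simp
    moreover have "midpoint a b \<in> F"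
      using that HF' a(5) by auto
    ultimately have "a \<in> F \<and> b \<in> F"
      using face_ofD[OF F(1), of "midpoint a b" a b] F(2) a(3,4) by blast
    then show ?thesis
      using a(1) by simp
  qed
  show thesis
    using L b H
  proof (cases rule: child_face_cases)
    case inherited
    then show ?thesis using that(1) by blast
  next
    case new
    then have "verts L \<subseteq> F"
      using redge HF' by (auto simp: new_face_def)
    then show ?thesis using F(3) by blast
  next
    case (cut G)
    then have "b \<in> F" "G - {b} \<subseteq> F"
      using redge HF' b by auto
    then have "G \<subseteq> F" by blast
    then have "convex hull G \<subseteq> F"
      using F(1) by (simp add: face_of_imp_convex hull_minimal)
    then show ?thesis using cut that(2) by blast
  qed
qed

text \<open>The bridge from tetrahedra to the planar rule: type and flag have disappeared, and the
  only ambient information left is whether \<open>G\<close> contains the refinement edge.\<close>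

lemma face_trace_children_face:
  assumes L: "marked_tetrahedron L" and G: "G \<in> faces L"
  shows "face_trace G (children L) =
    (if redge L \<subseteq> G then bisections (G, fmark L G) else {(G, fmark L G)})"
proof -
  note LD = marked_tetrahedronD[OF L]
  have GV: "G \<subseteq> verts L" "card G = 3" "finite G"
    using facesD[OF G] by auto
  have face_of: "convex hull G face_of convex hull (verts L)"
    using face_of_convex_hull_affine_independent[OF LD(2)] GV(1) by blast
  have nsub: "\<not> verts L \<subseteq> convex hull G"
  proof
    assume "verts L \<subseteq> convex hull G"
    then have "convex hull (verts L) \<subseteq> convex hull G"
      by (simp add: hull_minimal)
    then have "verts L \<subseteq> G"
      using independent_hull_subset[OF LD(2)] GV(1) by blast
    then have "card (verts L) \<le> card G"
      using GV(3) card_mono by blast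
    then show False using GV(2) LD(1) by simp
  qed
  have eqG: "F = G" if "F \<in> faces L" "convex hull F \<subseteq> convex hull G" for F
    using independent_hull_subset[OF LD(2) facesD(1)[OF that(1)] GV(1) that(2)]
      face_subset_eq[OF that(1) G] by blast
  have forward: "H = verts L - {b} \<and> H = G \<and> child_mark L H = fmark L G \<or>
      redge L \<subseteq> G \<and> H = insert (mid (redge L)) (G - {b}) \<and> child_mark L H = G - {b}"
    if "b \<in> redge L" "H \<in> faces (child L b)" "convex hull H \<subseteq> convex hull G" for b H
    using L that(1,2) face_of hull_subset nsub that(3)
  proof (cases rule: child_face_in_face)
    case inherited
    then show ?thesis using eqG[of H] that(3) by blast
  next
    case (cut G')
    then show ?thesis using eqG[of G'] by blast
  qed
  show ?thesis
  proof (cases "redge L \<subseteq> G")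
    case True
    have mark: "fmark L G = redge L"
      using LD(9)[OF G True] .
    have "face_trace G (children L) = bisections (G, redge L)"
    proof (intro set_eqI iffI)
      fix x assume "x \<in> face_trace G (children L)"
      then obtain b H where b: "b \<in> redge L" "H \<in> faces (child L b)"
          "convex hull H \<subseteq> convex hull G" and x: "x = (H, child_mark L H)"
        by (auto simp: face_trace_def children_def fmark_child)
      then show "x \<in> bisections (G, redge L)"
        using forward[OF b] True by (auto simp: bisections_def)
    next
      fix x assume "x \<in> bisections (G, redge L)"
      then obtain b where b: "b \<in> redge L"
          and x: "x = (insert (mid (redge L)) (G - {b}), G - {b})"
        by (auto simp: bisections_def)
      let ?H = "insert (mid (redge L)) (G - {b})"
      have edge: "redge L \<in> edges G"
        using LD(5) True by (simp add: edges_def)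
      have "card ?H = 3"
        using mid_insert_card[of G "redge L" b] affine_independent_subset[OF LD(2) GV(1)]
          edge b GV(2) by simp
      then have H: "?H \<in> faces (child L b)"
        using GV(1) by (auto simp: faces_def triangles_def verts_child)
      have hull: "convex hull ?H \<subseteq> convex hull G"
        using mid_in_convex_hull[OF edge] by (intro hull_minimal) (auto intro: hull_inc)
      have "?H \<noteq> G"
        using LD(7) GV(1) by blast
      \<comment> \<open>Since \<open>?H\<close> differs from \<open>G\<close>, the inherited
        alternative of \<open>forward\<close> is impossible and the other one gives the
        mark.\<close>
      then have "child_mark L ?H = G - {b}"
        using forward[OF b H hull] by blast
      then show "x \<in> face_trace G (children L)"
        using H hull b x by (auto simp: face_trace_iff children_def fmark_child)
    qed
    then show ?thesis using True mark by simp
  next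
    case False
    then obtain b where b: "b \<in> redge L" "b \<notin> G" by blast
    have "G \<in> faces (child L b)"
      using GV b by (auto simp: faces_def triangles_def verts_child)
    then have "(G, fmark L G) \<in> face_trace G (children L)"
      using b G by (auto simp: face_trace_iff children_def fmark_child child_mark_def)
    moreover have "x = (G, fmark L G)" if tr: "x \<in> face_trace G (children L)" for x
    proof -
      obtain b H where b: "b \<in> redge L" "H \<in> faces (child L b)"
          "convex hull H \<subseteq> convex hull G" and x: "x = (H, child_mark L H)"
        using tr by (auto simp: face_trace_def children_def fmark_child)
      then show ?thesis
        using forward[OF b] False by auto
    qed
    ultimately have "face_trace G (children L) = {(G, fmark L G)}" by blast
    then show ?thesis using False by simp
  qed
qed

text \<open>Traces can be computed face by face: a child face inside \<open>F\<close> is inherited,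
  or cut from a face of \<open>L\<close> that itself lies in \<open>F\<close>.\<close>

lemma face_trace_children:
  assumes K: "marked_tetrahedron K" and F: "F \<in> faces K" and L: "L \<in> descendants K"
  shows "face_trace F (children L) =
    (\<Union>G\<in>{G\<in>faces L. convex hull G \<subseteq> convex hull F}. face_trace G (children L))"
proof (intro set_eqI iffI)
  fix x assume "x \<in> face_trace F (children L)"
  then obtain b H where b: "b \<in> redge L" "H \<in> faces (child L b)"
      "convex hull H \<subseteq> convex hull F" and x: "x = (H, child_mark L H)"
    by (auto simp: face_trace_def children_def fmark_child)
  have tL: "marked_tetrahedron L" "verts L \<subseteq> convex hull (verts K)"
    using descendants_props[OF L K] by auto
  have face_of: "convex hull F face_of convex hull (verts K)"
    using face_of_convex_hull_affine_independent[OF marked_tetrahedronD(2)[OF K]] facesD(1)[OF F]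
    by blast
  \<comment> \<open>A tetrahedron has affine dimension 3 and does not fit into the plane of
    \<open>F\<close>.\<close>
  have nsub: "\<not> verts L \<subseteq> convex hull F"
  proof
    assume "verts L \<subseteq> convex hull F"
    then have "aff_dim (verts L) \<le> aff_dim F"
      by (metis aff_dim_convex_hull aff_dim_subset)
    then show False
      using aff_dim_affine_independent[OF marked_tetrahedronD(2)[OF tL(1)]]
        marked_tetrahedronD(1)[OF tL(1)] aff_dim_le_card[OF facesD(3)[OF F]] facesD(2)[OF F]
      by simp
  qed
  have "\<exists>G\<in>faces L. convex hull G \<subseteq> convex hull F \<and> convex hull H \<subseteq> convex hull G"
    using tL(1) b(1,2) face_of tL(2) nsub b(3)
  proof (cases rule: child_face_in_face)
    case inherited
    then show ?thesis using b(3) by blast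
  next
    case (cut G)
    have "redge L \<in> edges G"
      using marked_tetrahedronD(5)[OF tL(1)] cut(2) by (simp add: edges_def)
    then have "convex hull H \<subseteq> convex hull G"
      using mid_in_convex_hull[of "redge L" G] cut(4)
      by (intro hull_minimal) (auto intro: hull_inc)
    then show ?thesis using cut by blast
  qed
  then show "x \<in> (\<Union>G\<in>{G\<in>faces L. convex hull G \<subseteq> convex hull F}. face_trace G (children L))"
    using b x by (auto simp: face_trace_iff children_def fmark_child)
qed (auto simp: face_trace_def)

section \<open>The trace tree is the planar tree\<close>

lemma face_trace_self:
  assumes K: "marked_tetrahedron K" and F: "F \<in> faces K"
  shows "face_trace F {K} = {(F, fmark K F)}"
proof -
  have "G = F" if "G \<in> faces K" "convex hull G \<subseteq> convex hull F" for G
    using independent_hull_subset[OF marked_tetrahedronD(2)[OF K] facesD(1)[OF that(1)]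
        facesD(1)[OF F] that(2)] face_subset_eq[OF that(1) F] by blast
  then show ?thesis
    using F by (auto simp: face_trace_def)
qed

lemma nondegenerate_face:
  assumes "marked_tetrahedron K" "F \<in> faces K"
  shows "nondegenerate (F, fmark K F)"
  using facesD[OF assms(2)] marked_tetrahedronD(2)[OF assms(1)] marked_tetrahedronD(8)[OF assms]
    affine_independent_subset by (auto simp: nondegenerate_def)

text \<open>Soundness: each ambient bisection either keeps a marked triangle or moves one step down
  the planar tree.\<close>

lemma descendant_face_in_tree:
  assumes K: "marked_tetrahedron K" and F: "F \<in> faces K" and L: "L \<in> descendants K"
    and G: "G \<in> faces L" "convex hull G \<subseteq> convex hull F"
  shows "((F, fmark K F), (G, fmark L G)) \<in> bisection_rel\<^sup>*"
  using L G
proof (induction arbitrary: G rule: descendants_induct)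
  case base
  then have "(G, fmark K G) \<in> face_trace F {K}"
    by (auto simp: face_trace_iff)
  then show ?case
    using face_trace_self[OF K F] by simp
next
  case (step L L')
  have "(G, fmark L' G) \<in> face_trace F (children L)"
    using step.hyps(2) step.prems by (auto simp: face_trace_iff)
  then obtain G' where G': "G' \<in> faces L" "convex hull G' \<subseteq> convex hull F"
      "(G, fmark L' G) \<in> face_trace G' (children L)"
    using face_trace_children[OF K F step.hyps(1)] by auto
  have "marked_tetrahedron L"
    using descendants_props[OF step.hyps(1) K] by blast
  then have "(G, fmark L' G) = (G', fmark L G') \<or>
      ((G', fmark L G'), (G, fmark L' G)) \<in> bisection_rel"
    using G' face_trace_children_face[of L G'] by (auto simp: bisection_rel_def split: if_splits)
  then show ?case
    using step.IH[OF G'(1,2)] by (metis rtrancl_into_rtrancl)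
qed

text \<open>If the refinement edge of \<open>L\<close> is not in \<open>G\<close>, then it is in \<open>G\<close> for the child inheriting \<open>G\<close>.\<close>

lemma descendant_splitting_face:
  assumes K: "marked_tetrahedron K" and L: "L \<in> descendants K" and G: "G \<in> faces L"
  obtains L' where "L' \<in> descendants K" "G \<in> faces L'" "fmark L' G = fmark L G" "redge L' \<subseteq> G"
proof (cases "redge L \<subseteq> G")
  case True
  then show ?thesis using that L G by blast
next
  case False
  then obtain b where b: "b \<in> redge L" "b \<notin> G" by blast
  have tL: "marked_tetrahedron L"
    using descendants_props[OF L K] by blast
  have bV: "b \<in> verts L"
    using b marked_tetrahedronD(4)[OF tL] by blast
  have "G = verts L - {b}"
    using face_subset_eq[OF G opposite_face[OF tL bV]] facesD(1)[OF G] b(2) by blast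
  then have "redge (child L b) = fmark L G"
    by (simp add: redge_child)
  then have "redge (child L b) \<subseteq> G"
    using marked_tetrahedronD(8)[OF tL G] by (simp add: edges_def)
  moreover have "G \<in> faces (child L b)"
    using facesD[OF G] b by (auto simp: faces_def triangles_def verts_child)
  moreover have "fmark (child L b) G = fmark L G"
    using G by (simp add: fmark_child child_mark_def)
  ultimately show ?thesis
    using that descendants_children[OF L, of "child L b"] b(1) by (simp add: children_def)
qed

text \<open>Completeness: the planar path is realized step by step. Requiring the refinement edge
  inside the triangle ensures that the next bisection splits it, which also realizes the outgoing
  tree edges.\<close>

lemma tree_face_descendant:
  assumes K: "marked_tetrahedron K" and F: "F \<in> faces K"
    and x: "((F, fmark K F), x) \<in> bisection_rel\<^sup>*"
  obtains L G where "L \<in> descendants K" "G \<in> faces L" "convex hull G \<subseteq> convex hull F"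
    "x = (G, fmark L G)" "redge L \<subseteq> G"
proof -
  have "\<exists>L\<in>descendants K. fst x \<in> faces L \<and> snd x = fmark L (fst x)"
    using x
  proof induction
    case base
    show ?case using F descendants_refl by auto
  next
    case (step y z)
    then obtain L where L: "L \<in> descendants K" "fst y \<in> faces L" "snd y = fmark L (fst y)"
      by blast
    then obtain L' where L': "L' \<in> descendants K" "fst y \<in> faces L'"
        "fmark L' (fst y) = snd y" "redge L' \<subseteq> fst y"
      using descendant_splitting_face[OF K L(1,2)] by metis
    have "marked_tetrahedron L'"
      using descendants_props[OF L'(1) K] by blast
    then have "z \<in> face_trace (fst y) (children L')"
      using face_trace_children_face[of L' "fst y"] L' step.hyps(2)
      by (simp add: bisection_rel_def)
    then show ?case
      using descendants_children[OF L'(1)] by (auto simp: face_trace_def)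
  qed
  then obtain L where L: "L \<in> descendants K" "fst x \<in> faces L" "snd x = fmark L (fst x)"
    by blast
  then obtain L' where L': "L' \<in> descendants K" "fst x \<in> faces L'"
      "fmark L' (fst x) = snd x" "redge L' \<subseteq> fst x"
    using descendant_splitting_face[OF K L(1,2)] by metis
  show thesis
    using that[OF L'(1,2) _ _ L'(4)] L'(3)
      convex_hull_bisections_rtrancl[OF x nondegenerate_face[OF K F]] by simp
qed

lemma trace_tree_eq_intrinsic_tree:
  assumes K: "marked_tetrahedron K" and F: "F \<in> faces K"
  shows "trace_tree K F = intrinsic_tree (F, fmark K F)"
proof -
  let ?r = "(F, fmark K F)"
  have nodes: "face_trace F (descendants K) = bisection_rel\<^sup>* `` {?r}"
  proof (intro set_eqI iffI)
    fix x assume "x \<in> face_trace F (descendants K)"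
    then show "x \<in> bisection_rel\<^sup>* `` {?r}"
      using descendant_face_in_tree[OF K F] by (auto simp: face_trace_def)
  next
    fix x assume "x \<in> bisection_rel\<^sup>* `` {?r}"
    then have "(?r, x) \<in> bisection_rel\<^sup>*" by simp
    then show "x \<in> face_trace F (descendants K)"
      using tree_face_descendant[OF K F] by (metis face_trace_iff)
  qed
  have "trace_edges K F = {(p, q). (?r, p) \<in> bisection_rel\<^sup>* \<and> q \<in> bisections p}"
  proof (intro set_eqI iffI)
    fix x assume "x \<in> trace_edges K F"
    then obtain L L' G H where x: "x = ((G, fmark L G), (H, fmark L' H))"
      and L: "L \<in> descendants K" "G \<in> faces L" "convex hull G \<subseteq> convex hull F"
        "L' \<in> children L" "H \<in> faces L'" "convex hull H \<subset> convex hull G"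
      unfolding trace_edges_def by blast
    have "marked_tetrahedron L"
      using descendants_props[OF L(1) K] by blast
    moreover have "(H, fmark L' H) \<in> face_trace G (children L)"
      using L by (auto simp: face_trace_iff)
    \<comment> \<open>Strict inclusion of \<open>H\<close> in \<open>G\<close> rules out the case in
      which \<open>G\<close> is left unchanged.\<close>
    ultimately have "(H, fmark L' H) \<in> bisections (G, fmark L G)"
      using face_trace_children_face[of L G] L(2,6) by (auto split: if_splits)
    then show "x \<in> {(p, q). (?r, p) \<in> bisection_rel\<^sup>* \<and> q \<in> bisections p}"
      using x descendant_face_in_tree[OF K F L(1-3)] by simp
  next
    fix x assume "x \<in> {(p, q). (?r, p) \<in> bisection_rel\<^sup>* \<and> q \<in> bisections p}"
    then obtain p q where x: "x = (p, q)" and p: "(?r, p) \<in> bisection_rel\<^sup>*" "q \<in> bisections p"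
      by auto
    obtain L G where L: "L \<in> descendants K" "G \<in> faces L" "convex hull G \<subseteq> convex hull F"
        "p = (G, fmark L G)" "redge L \<subseteq> G"
      using tree_face_descendant[OF K F p(1)] .
    have tL: "marked_tetrahedron L"
      using descendants_props[OF L(1) K] by blast
    then have "q \<in> face_trace G (children L)"
      using face_trace_children_face[of L G] L p(2) by simp
    moreover have "convex hull (fst q) \<subset> convex hull G"
      using convex_hull_bisections[OF _ p(2)] nondegenerate_face[OF tL L(2)] L(4) by simp
    ultimately show "x \<in> trace_edges K F"
      using x L unfolding trace_edges_def face_trace_def by fastforce
  qed
  then show ?thesis
    using nodes by (simp add: trace_tree_def intrinsic_tree_def)
qed

lemma face_trace_children_dichotomy:
  assumes "marked_tetrahedron L" "G \<in> faces L"
  shows "face_trace G (children L) = {(G, fmark L G)} \<or>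
    fst ` face_trace G (children L) = halves G (fmark L G)"
  using face_trace_children_face[OF assms] fst_bisections[of G "fmark L G"] by (auto split: if_splits)

section \<open>Bisection histories\<close>

lemma stage_subset_descendants:
  assumes "bisection_history K L n"
  shows "stage K L n \<subseteq> descendants K"
  using assms
proof (induction n)
  case 0
  then show ?case by (simp add: descendants_refl)
next
  case (Suc n)
  then have "stage K L n \<subseteq> descendants K" "L n \<in> stage K L n"
    by (auto simp: bisection_history_def)
  then show ?case
    using descendants_children by auto
qed

lemma bisection_history_mono:
  "bisection_history K L n \<Longrightarrow> i \<le> n \<Longrightarrow> bisection_history K L i"
  by (auto simp: bisection_history_def)

lemma bisection_history_descendant:
  assumes "bisection_history K L n" "i < n"
  shows "L i \<in> stage K L i" "L i \<in> descendants K"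
proof -
  show "L i \<in> stage K L i"
    using assms by (simp add: bisection_history_def)
  then show "L i \<in> descendants K"
    using stage_subset_descendants[OF bisection_history_mono[OF assms(1)], of i] assms(2) by auto
qed

lemma trace_vertices_iff:
  "v \<in> trace_vertices F S \<longleftrightarrow>
    (\<exists>L\<in>S. \<exists>G\<in>faces L. convex hull G \<subseteq> convex hull F \<and> v \<in> G)"
  by (auto simp: trace_vertices_def face_trace_def)

text \<open>No vertex is lost: the mark has two endpoints, so some endpoint differs from
  \<open>v\<close>, and the half that drops this endpoint retains \<open>v\<close>.\<close>

lemma trace_vertices_children:
  assumes L: "marked_tetrahedron L" and G: "G \<in> faces L"
  shows "G \<subseteq> trace_vertices G (children L)"
proof
  fix v assume v: "v \<in> G"
  show "v \<in> trace_vertices G (children L)"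
  proof (cases "redge L \<subseteq> G")
    case False
    then show ?thesis
      using face_trace_children_face[OF assms] v by (simp add: trace_vertices_def)
  next
    case True
    have "card (fmark L G) = 2"
      using marked_tetrahedronD(8)[OF assms] by (simp add: edges_def)
    then obtain b where "b \<in> fmark L G" "b \<noteq> v"
      by (metis card_2_iff insertI1 insertI2)
    then have "\<exists>x\<in>bisections (G, fmark L G). v \<in> fst x"
      using v by (auto simp: bisections_def)
    then show ?thesis
      using face_trace_children_face[OF assms] True by (simp add: trace_vertices_def)
  qed
qed

text \<open>An invariant of bisection: while \<open>F\<close> is unrefined, its first split must be
  at the midpoint of its mark, and once that midpoint is a trace vertex it remains one.\<close>

lemma trace_stage:
  assumes K: "marked_tetrahedron K" and F: "F \<in> faces K" and hist: "bisection_history K L n"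
  shows "face_trace F (stage K L n) = {(F, fmark K F)} \<or>
    mid (fmark K F) \<in> trace_vertices F (stage K L n)"
  using hist
proof (induction n)
  case 0
  show ?case using face_trace_self[OF K F] by simp
next
  case (Suc n)
  have hist: "bisection_history K L n"
    using Suc.prems by (rule bisection_history_mono) simp
  have Ln: "L n \<in> stage K L n" "L n \<in> descendants K"
    using bisection_history_descendant[OF Suc.prems] by auto
  have tL: "marked_tetrahedron (L n)"
    using descendants_props[OF Ln(2) K] by blast
  let ?\<mu> = "fmark K F"
  consider "face_trace F (stage K L n) = {(F, ?\<mu>)}" | "mid ?\<mu> \<in> trace_vertices F (stage K L n)"
    using Suc.IH[OF hist] by blast
  then show ?case
  proof cases
    case 1
    have old: "face_trace F (stage K L n - {L n}) \<subseteq> {(F, ?\<mu>)}"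
      using 1 face_trace_mono[of "stage K L n - {L n}" "stage K L n" F] by auto
    have face: "G = F \<and> fmark (L n) G = ?\<mu>"
      if "G \<in> faces (L n)" "convex hull G \<subseteq> convex hull F" for G
    proof -
      have "(G, fmark (L n) G) \<in> face_trace F (stage K L n)"
        using that Ln(1) by (auto simp: face_trace_iff)
      then show ?thesis using 1 by auto
    qed
    show ?thesis
    proof (cases "F \<in> faces (L n) \<and> redge (L n) \<subseteq> F")
      case True
      have "fmark (L n) F = ?\<mu>"
        using face True by blast
      then have tr: "face_trace F (children (L n)) = bisections (F, ?\<mu>)"
        using face_trace_children_face[OF tL, of F] True by simp
      have "?\<mu> \<noteq> {}"
        using marked_tetrahedronD(8)[OF K F] by (auto simp: edges_def)
      then have "mid ?\<mu> \<in> trace_vertices F (children (L n))"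
        unfolding trace_vertices_def tr by (auto simp: bisections_def)
      then show ?thesis
        by (auto simp: trace_vertices_iff)
    next
      case False
      have "face_trace F (children (L n)) \<subseteq> {(F, ?\<mu>)}"
        unfolding face_trace_children[OF K F Ln(2)]
      proof (rule UN_least)
        fix G assume G: "G \<in> {G \<in> faces (L n). convex hull G \<subseteq> convex hull F}"
        then have "G = F" "fmark (L n) G = ?\<mu>"
          using face by auto
        then show "face_trace G (children (L n)) \<subseteq> {(F, ?\<mu>)}"
          using face_trace_children_face[OF tL, of G] G False by auto
      qed
      then have "face_trace F (stage K L (Suc n)) \<subseteq> {(F, ?\<mu>)}"
        using old by (simp add: face_trace_Un)
      \<comment> \<open>The inclusion alone would allow an empty trace. \<open>F\<close> persists
        either in the child of \<open>L n\<close> inheriting it or in an element that is not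
        bisected.\<close>
      moreover have "face_trace F (stage K L (Suc n)) \<noteq> {}"
      proof -
        have "(F, ?\<mu>) \<in> face_trace F (stage K L n)"
          using 1 by simp
        then obtain L' where L': "L' \<in> stage K L n" "F \<in> faces L'" "?\<mu> = fmark L' F"
          by (auto simp: face_trace_iff)
        show ?thesis
        proof (cases "L' = L n")
          case True
          then have "(F, fmark (L n) F) \<in> face_trace F (children (L n))"
            using False L'(2) face_trace_children_face[OF tL, of F] by simp
          then show ?thesis by (auto simp: face_trace_Un)
        next
          case False
          then have "(F, ?\<mu>) \<in> face_trace F (stage K L n - {L n})"
            using L' by (auto simp: face_trace_iff)
          then show ?thesis by (auto simp: face_trace_Un)
        qed
      qed
      ultimately show ?thesis by (simp add: subset_singleton_iff)
    qed
  next
    case 2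
    then obtain L' G where G: "L' \<in> stage K L n" "G \<in> faces L'"
        "convex hull G \<subseteq> convex hull F" "mid ?\<mu> \<in> G"
      by (auto simp: trace_vertices_iff)
    show ?thesis
    proof (cases "L' = L n")
      case True
      have "mid ?\<mu> \<in> trace_vertices G (children (L n))"
        using trace_vertices_children[OF tL] G True by blast
      then show ?thesis
        using G(3) by (fastforce simp: trace_vertices_iff)
    next
      case False
      then show ?thesis
        using G by (auto simp: trace_vertices_iff)
    qed
  qed
qed

text \<open>The midpoint is absent at stage 0, not being a vertex of \<open>F\<close>, and present
  at stage \<open>i\<close>, because a strictly smaller triangle \<open>G\<close> is already there.
  So it appears in a step \<open>j < i\<close>, whereas the bisection splitting \<open>G\<close> is
  step \<open>i\<close>.\<close>

lemma mid_created_before: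
  assumes K: "marked_tetrahedron K" and F: "F \<in> faces K" and hist: "bisection_history K L i"
    and G: "L i \<in> stage K L i" "G \<in> faces (L i)" "convex hull G \<subset> convex hull F"
  shows "\<exists>j<i. created_at K F L j (mid (fmark K F))"
proof -
  let ?P = "\<lambda>j. mid (fmark K F) \<in> trace_vertices F (stage K L j)"
  have "(G, fmark (L i) G) \<in> face_trace F (stage K L i)"
    unfolding face_trace_iff using G by blast
  moreover have "G \<noteq> F"
    using G(3) by blast
  ultimately have "?P i"
    using trace_stage[OF K F hist] by auto
  moreover have "\<not> ?P 0"
    using face_trace_self[OF K F] nondegenerate_face[OF K F] mid_notin
    by (auto simp: trace_vertices_def nondegenerate_def)
  ultimately obtain j where "j < i" "\<not> ?P j" "?P (Suc j)"
    using ex_least_nat_less[of ?P i] by auto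
  then show ?thesis
    unfolding created_at_def by blast
qed

theorem lemma3p6:
  "\<exists>\<F> :: marked_triangle \<Rightarrow> marked_triangle set \<times> marked_triangle rel.
     \<forall>T F \<mu>. conformingly_marked T \<and> (F, \<mu>) \<in> marked_faces T \<longrightarrow>
       binary_tree (F, \<mu>) (\<F> (F, \<mu>)) \<and>
       (\<forall>K\<in>sides T F.
          trace_tree K F = \<F> (F, \<mu>) \<and>
          (\<forall>L n. bisection_history K L n \<longrightarrow>
             (\<forall>i<n. \<forall>G\<in>faces (L i). convex hull G \<subseteq> convex hull F \<longrightarrow>
                face_trace G (children (L i)) = {(G, fmark (L i) G)} \<or>
                fst ` face_trace G (children (L i)) = halves G (fmark (L i) G)) \<and>
             (fst ` face_trace F (stage K L n) \<noteq> {F} \<longrightarrow>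
                mid \<mu> \<in> trace_vertices F (stage K L n)) \<and>
             (\<forall>i<n. \<forall>G v.
                ((F, \<mu>), (G, fmark (L i) G)) \<in> (snd (\<F> (F, \<mu>)))\<^sup>+ \<and>
                introduces (L i) G v \<longrightarrow>
                (\<exists>j<i. created_at K F L j (mid \<mu>)))))"
\<comment> \<open>The witness is fixed before the mesh and the side, which is what makes the tree
  intrinsic.\<close>
proof (rule exI[of _ intrinsic_tree], intro allI impI)
  fix T F \<mu>
  assume asm: "conformingly_marked T \<and> (F, \<mu>) \<in> marked_faces T"
  \<comment> \<open>The mark \<mu> may have been read off from another element; conforming marking
    transfers it to every side of \<open>F\<close>.\<close>
  have sides: "marked_tetrahedron K \<and> F \<in> faces K \<and> fmark K F = \<mu>" if "K \<in> sides T F" for K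
  proof -
    obtain K' where K': "K' \<in> T" "F \<in> faces K'" "\<mu> = fmark K' F"
      using conjunct2[OF asm] by (auto simp: marked_faces_def)
    have K: "K \<in> T" "F \<in> faces K"
      using that by (auto simp: sides_def)
    have "\<forall>K\<in>T. \<forall>L\<in>T. \<forall>F\<in>faces K \<inter> faces L. fmark K F = fmark L F"
      "\<forall>K\<in>T. marked_tetrahedron K"
      using asm unfolding conformingly_marked_def amp_mesh_def by blast+
    then show ?thesis
      using K K' by blast
  qed
  obtain K\<^sub>0 where "K\<^sub>0 \<in> sides T F"
    using conjunct2[OF asm] by (auto simp: marked_faces_def sides_def)
  then have tree: "binary_tree (F, \<mu>) (intrinsic_tree (F, \<mu>))"
    using sides[of K\<^sub>0] nondegenerate_face[of K\<^sub>0 F] binary_tree_intrinsic_tree by auto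
  have trace: "trace_tree K F = intrinsic_tree (F, \<mu>)" if "K \<in> sides T F" for K
    using sides[OF that] trace_tree_eq_intrinsic_tree by blast
  have dichotomy: "face_trace G (children (L i)) = {(G, fmark (L i) G)} \<or>
      fst ` face_trace G (children (L i)) = halves G (fmark (L i) G)"
    if "K \<in> sides T F" "bisection_history K L n" "i < n" "G \<in> faces (L i)" for K L n i G
    using face_trace_children_dichotomy[of "L i" G] that(4) sides[OF that(1)]
      descendants_props[OF bisection_history_descendant(2)[OF that(2,3)]] by blast
  have mid: "mid \<mu> \<in> trace_vertices F (stage K L n)"
    if "K \<in> sides T F" "bisection_history K L n" "fst ` face_trace F (stage K L n) \<noteq> {F}" for K L n
  proof -
    have K: "marked_tetrahedron K" "F \<in> faces K" "fmark K F = \<mu>"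
      using sides[OF that(1)] by auto
    have "face_trace F (stage K L n) \<noteq> {(F, \<mu>)}"
      using that(3) by auto
    then show ?thesis
      using trace_stage[OF K(1,2) that(2)] K(3) by simp
  qed
  have created: "\<exists>j<i. created_at K F L j (mid \<mu>)"
    if "K \<in> sides T F" "bisection_history K L n" "i < n"
      "((F, \<mu>), (G, fmark (L i) G)) \<in> (snd (intrinsic_tree (F, \<mu>)))\<^sup>+ \<and>
        introduces (L i) G v" for K L n i G v
  proof -
    have K: "marked_tetrahedron K" "F \<in> faces K" "fmark K F = \<mu>"
      using sides[OF that(1)] by auto
    have "snd (intrinsic_tree (F, \<mu>)) \<subseteq> bisection_rel"
      by (auto simp: intrinsic_tree_def bisection_rel_def)
    then have "((F, \<mu>), (G, fmark (L i) G)) \<in> bisection_rel\<^sup>+"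
      using conjunct1[OF that(4)] trancl_mono by blast
    \<comment> \<open>Being a proper descendant of the root becomes strict geometric inclusion, the
      form that \<open>mid_created_before\<close> requires.\<close>
    then have "convex hull G \<subset> convex hull F"
      using convex_hull_bisections_trancl nondegenerate_face[OF K(1,2)] K(3) by force
    moreover have "bisection_history K L i"
      using bisection_history_mono[OF that(2)] that(3) by simp
    ultimately show ?thesis
      using mid_created_before[OF K(1,2), of L i G] conjunct2[OF that(4)] K(3)
        bisection_history_descendant(1)[OF that(2,3)] by (simp add: introduces_def)
  qed
  show "binary_tree (F, \<mu>) (intrinsic_tree (F, \<mu>)) \<and>
       (\<forall>K\<in>sides T F.
          trace_tree K F = intrinsic_tree (F, \<mu>) \<and>
          (\<forall>L n. bisection_history K L n \<longrightarrow>
             (\<forall>i<n. \<forall>G\<in>faces (L i). convex hull G \<subseteq> convex hull F \<longrightarrow>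
                face_trace G (children (L i)) = {(G, fmark (L i) G)} \<or>
                fst ` face_trace G (children (L i)) = halves G (fmark (L i) G)) \<and>
             (fst ` face_trace F (stage K L n) \<noteq> {F} \<longrightarrow>
                mid \<mu> \<in> trace_vertices F (stage K L n)) \<and>
             (\<forall>i<n. \<forall>G v.
                ((F, \<mu>), (G, fmark (L i) G)) \<in> (snd (intrinsic_tree (F, \<mu>)))\<^sup>+ \<and>
                introduces (L i) G v \<longrightarrow>
                (\<exists>j<i. created_at K F L j (mid \<mu>)))))"
    by (intro conjI ballI allI impI)
      (rule tree trace | rule dichotomy mid created, assumption+ | assumption)+
qed

end
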